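(* Let $X$ be a finite set and let $\delta:2^X\to\mathbb{R}$ be a function on subsets of $X$ such that $\delta(\emptyset)=0$. For $x\in X$ let $\delta_x:2^{X\setminus\{x\}}\to\mathbb{R}$ be given by $\delta_x(A)=\delta(A\cup\{x\})$. The following are equivalent: (i) $(X,\delta)$ is a diversity of negative type; (ii) for all $x\in X$ the function $\delta_x:2^{X\setminus\{x\}}\to\mathbb{R}$ is strongly submodular and zero on the empty set; (iii) $\delta$ is zero on singletons and is strongly intersecting submodular; (iv) for all $x\in X$ there is an $\ell_1$-embeddable diversity $(X,\delta_1^{(x)})$ such that $\delta(A)=\delta_1^{(x)}(A)$ for all $A\subseteq X$ such that $x\in A$.
   Context: A diversity is a pair $(X,\delta)$ where $X$ is a set and $\delta$ is a real-valued function on finite subsets of $X$ satisfying (D1') $\delta(A)=0$ if $|A|\le 1$, and (D2) $\delta(A\cup C)\le \delta(A\cup B)+\delta(B\cup C)$ for all finite $A,B,C\subseteq X$ with $B\neq\emptyset$. (So $\delta$ may vanish on sets with two or more elements.) For finite $X$, a diversity $(X,\delta)$ has negative type if $\sum_{A,B\subseteq X}\mathbf{x}_A\mathbf{x}_B\,\delta(A\cup B)\le 0$ for all real vectors $\mathbf{x}$ indexed by subsets of $X$ with $\mathbf{x}_\emptyset=0$ and $\sum_{A\ne\emptyset}\mathbf{x}_A=0$. For a finite set $Z$, a function $f:2^Z\to\mathbb{R}$ is strongly submodular if $$\sum_{K\subseteq\{1,\ldots,m\}}(-1)^{|K|}f\Big(A_0\cup\bigcup_{i\in K}A_i\Big)\le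 0$$ for all $m\ge 1$ and all $A_0,A_1,\ldots,A_m\in 2^Z$; it is strongly intersecting submodular if this inequality holds for all $m\ge1$ and all $A_0,A_1,\ldots,A_m\in 2^Z$ with $A_0\neq\emptyset$. The $\ell_1$ diversity $(\mathbb{R}^k,\delta_1)$ is given by $\delta_1(\emptyset)=0$ and $\delta_1(A)=\sum_{i=1}^k\max\{|a_i-b_i|:a,b\in A\}$ for finite nonempty $A\subseteq\mathbb{R}^k$. A diversity $(X,\delta)$ is $\ell_1$-embeddable if for some $k\ge1$ there is a map $\phi:X\to\mathbb{R}^k$ (not required to be injective) with $\delta_1(\phi(A))=\delta(A)$ for all finite $A\subseteq X$. *)

theory Defs
  imports Complex_Main "HOL-Library.FuncSet"
begin

text \<open>The structure \<open>(X, \<delta>)\<close> is represented by a carrier \<open>X\<close> and a total function \<open>\<delta>\<close> on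
  \<open>'a set\<close>; only the values of \<open>\<delta>\<close> on finite subsets of \<open>X\<close> are ever constrained.
  Condition (D1') is used: \<open>\<delta>\<close> may vanish on sets with two or more elements.\<close>

definition diversity :: "'a set \<Rightarrow> ('a set \<Rightarrow> real) \<Rightarrow> bool" where
  "diversity X \<delta> \<longleftrightarrow>
     (\<forall>A. finite A \<and> A \<subseteq> X \<and> card A \<le> 1 \<longrightarrow> \<delta> A = 0) \<and>
     (\<forall>A B C. finite A \<and> finite B \<and> finite C \<and> A \<subseteq> X \<and> B \<subseteq> X \<and> C \<subseteq> X \<and> B \<noteq> {}
        \<longrightarrow> \<delta> (A \<union> C) \<le> \<delta> (A \<union> B) + \<delta> (B \<union> C))"

text \<open>To be used for finite \<open>X\<close> only (otherwise the sums are zero by convention).\<close>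

definition negative_type :: "'a set \<Rightarrow> ('a set \<Rightarrow> real) \<Rightarrow> bool" where
  "negative_type X \<delta> \<longleftrightarrow>
     (\<forall>x :: 'a set \<Rightarrow> real. x {} = 0 \<and> (\<Sum>A\<in>Pow X - {{}}. x A) = 0
        \<longrightarrow> (\<Sum>A\<in>Pow X. \<Sum>B\<in>Pow X. x A * x B * \<delta> (A \<union> B)) \<le> 0)"

definition strongly_submodular :: "'a set \<Rightarrow> ('a set \<Rightarrow> real) \<Rightarrow> bool" where
  "strongly_submodular Z f \<longleftrightarrow>
     (\<forall>m\<ge>1. \<forall>A :: nat \<Rightarrow> 'a set. (\<forall>i\<le>m. A i \<subseteq> Z)
        \<longrightarrow> (\<Sum>K\<in>Pow {1..m}. (-1) ^ card K * f (A 0 \<union> (\<Union>i\<in>K. A i))) \<le> 0)"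

definition strongly_intersecting_submodular :: "'a set \<Rightarrow> ('a set \<Rightarrow> real) \<Rightarrow> bool" where
  "strongly_intersecting_submodular Z f \<longleftrightarrow>
     (\<forall>m\<ge>1. \<forall>A :: nat \<Rightarrow> 'a set. (\<forall>i\<le>m. A i \<subseteq> Z) \<and> A 0 \<noteq> {}
        \<longrightarrow> (\<Sum>K\<in>Pow {1..m}. (-1) ^ card K * f (A 0 \<union> (\<Union>i\<in>K. A i))) \<le> 0)"

text \<open>Since the dimension \<open>k\<close> is existentially quantified below, \<open>\<real>\<^sup>k\<close> is represented by the
  extensional functions on \<open>{1..k}\<close>.\<close>

definition real_space :: "nat \<Rightarrow> (nat \<Rightarrow> real) set" where
  "real_space k = {1..k} \<rightarrow>\<^sub>E UNIV"

definition l1_diversity :: "nat \<Rightarrow> (nat \<Rightarrow> real) set \<Rightarrow> real" where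
  "l1_diversity k A =
     (if A = {} then 0 else \<Sum>i=1..k. Max {\<bar>a i - b i\<bar> |a b. a \<in> A \<and> b \<in> A})"

definition l1_embeddable :: "'a set \<Rightarrow> ('a set \<Rightarrow> real) \<Rightarrow> bool" where
  "l1_embeddable X \<delta> \<longleftrightarrow>
     (\<exists>k\<ge>1. \<exists>\<phi>. \<phi> \<in> X \<rightarrow> real_space k \<and>
        (\<forall>A. finite A \<and> A \<subseteq> X \<longrightarrow> l1_diversity k (\<phi> ` A) = \<delta> A))"

text \<open>The function \<open>\<delta>\<^sub>x\<close>, to be considered on subsets of \<open>X - {x}\<close>.\<close>

definition based_at :: "('a set \<Rightarrow> real) \<Rightarrow> 'a \<Rightarrow> 'a set \<Rightarrow> real" where
  "based_at \<delta> x A = \<delta> (A \<union> {x})"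

end

theory Submission imports Defs begin

text \<open>Condition (iii), strong intersecting submodularity together with \<open>\<delta> {x} = 0\<close> for all
  \<open>x\<close>, is compared with each of the other three conditions. It makes \<open>\<delta>\<close> a diversity through the
  inequalities with \<open>m = 1\<close> (monotonicity) and \<open>m = 2\<close>.

  The link to negative type comes from two expansions. For
  \<open>B K = A\<^sub>0 \<union> (\<Union>i\<in>K. A\<^sub>i)\<close>, the quadratic form of \<open>\<delta>\<close> at the vector
  \<open>\<Sum>K. (-1)^|K| e\<^bsub>B K\<^esub>\<close> collapses to the alternating sum of the values \<open>\<delta> (B K)\<close>
  (\<open>alternating_double_sum_union\<close>), so negative type gives strong intersecting submodularity. Conversely, Moebius inversion writes
  every \<open>\<delta>\<close> as \<open>\<delta> A = - (\<Sum>S. w S)\<close>, summed over the \<open>S \<subseteq> X\<close> that miss \<open>A\<close>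
  (\<open>moebius_representation\<close>). Under (iii) the weight \<open>w S\<close> is nonnegative for nonempty proper
  \<open>S\<close> (\<open>moebius_weight_nonneg\<close>), since it is minus an alternating sum based at \<open>X - S\<close> over the
  points of \<open>S\<close>. A union misses \<open>S\<close> iff both of its parts do, so the
  quadratic form of \<open>\<delta>\<close> is \<open>- (\<Sum>S. w S * (q S)\<^sup>2)\<close>, where \<open>q S\<close> is the sum of the
  coordinates indexed by sets missing \<open>S\<close>. The two weights of unknown sign are harmless: \<open>q {}\<close>
  and \<open>q X\<close> are the two sums that the definition of negative type requires to vanish.

  The same weights give the \<open>\<ell>\<^sub>1\<close> diversities of (iv). If \<open>\<delta> {x} = 0\<close> and \<open>x \<in> A\<close>, then
  subtracting the representations of \<open>\<delta> {x}\<close> and \<open>\<delta> A\<close> leaves the sum of \<open>w S\<close> over the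
  \<open>S\<close> that avoid \<open>x\<close> and meet \<open>A\<close>. These are the \<open>S \<subseteq> X - {x}\<close> that cut \<open>A\<close> into two
  nonempty parts, and a nonnegative combination of cuts embeds in \<open>\<ell>\<^sub>1\<close> with one coordinate per
  cut. In the other direction, the \<open>\<ell>\<^sub>1\<close> diversity is a sum of terms \<open>max f\<close> and \<open>max (-f)\<close>,
  and the maximum is strongly intersecting submodular by the maximum-minimums identity
  (\<open>alternating_sum_Max\<close>). All sets in one inequality of (iii) contain a common point \<open>x\<close> of
  \<open>A\<^sub>0\<close>, so it is enough that for each \<open>x\<close> the function agrees with one such diversity on the sets
  containing \<open>x\<close>. The same remark shows that (ii) and (iii) are equivalent.\<close>

section \<open>Alternating sums over subsets\<close>

lemma sum_Pow_insert:
  fixes f :: "'b set \<Rightarrow> 'c::comm_monoid_add"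
  assumes "finite S" "j \<notin> S"
  shows "(\<Sum>K\<in>Pow (insert j S). f K) = (\<Sum>K\<in>Pow S. f K + f (insert j K))"
proof -
  have "inj_on (insert j) (Pow S)"
    using assms(2) by (intro inj_onI) (auto simp: set_eq_iff)
  moreover have "Pow S \<inter> insert j ` Pow S = {}"
    using assms(2) by auto
  ultimately show ?thesis
    using assms(1) by (simp add: Pow_insert sum.union_disjoint sum.reindex sum.distrib)
qed

lemma alternating_sum_Pow_insert:
  fixes F :: "'b set \<Rightarrow> real"
  assumes "finite S" "j \<notin> S"
  shows "(\<Sum>K\<in>Pow (insert j S). (-1) ^ card K * F K)
    = (\<Sum>K\<in>Pow S. (-1) ^ card K * (F K - F (insert j K)))"
proof -
  have "card (insert j K) = Suc (card K)" if "K \<in> Pow S" for K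
    using assms that by (subst card_insert_disjoint) (auto intro: finite_subset)
  then show ?thesis
    unfolding sum_Pow_insert[OF assms] by (intro sum.cong) (simp_all add: algebra_simps)
qed

lemma alternating_sum_Pow_const:
  assumes "finite S" "S \<noteq> {}"
  shows "(\<Sum>K\<in>Pow S. (-1) ^ card K) = (0::real)"
proof -
  obtain j T where "S = insert j T" "j \<notin> T"
    using assms(2) by (metis ex_in_conv mk_disjoint_insert)
  then show ?thesis
    using alternating_sum_Pow_insert[of T j "\<lambda>_. 1"] assms(1) by simp
qed

text \<open>A set \<open>U\<close> keeps the coefficient \<open>(-1)^|U|\<close>, because each point of \<open>U = K \<union> L\<close> lies in \<open>K\<close>
  only, in \<open>L\<close> only, or in both, with total sign \<open>- 1 - 1 + 1 = - 1\<close>. In the induction a new point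
  \<open>j\<close> replaces \<open>F\<close> by the difference \<open>F U - F (insert j U)\<close> on both sides.\<close>

lemma alternating_double_sum_union:
  fixes F :: "'b set \<Rightarrow> real"
  assumes "finite S"
  shows "(\<Sum>K\<in>Pow S. \<Sum>L\<in>Pow S. (-1) ^ card K * (-1) ^ card L * F (K \<union> L))
    = (\<Sum>K\<in>Pow S. (-1) ^ card K * F K)"
  using assms
proof (induction S arbitrary: F rule: finite_induct)
  case empty
  then show ?case by simp
next
  case (insert j S)
  \<comment> \<open>Split off \<open>j\<close> in both sums: of the four resulting terms the three with \<open>j\<close> in the union
    combine to a single negative one.\<close>
  note step = alternating_sum_Pow_insert[OF insert(1,2)]
  have "(\<Sum>K\<in>Pow (insert j S). \<Sum>L\<in>Pow (insert j S).
          (-1) ^ card K * (-1) ^ card L * F (K \<union> L))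
      = (\<Sum>K\<in>Pow (insert j S). (-1) ^ card K *
          (\<Sum>L\<in>Pow (insert j S). (-1) ^ card L * F (K \<union> L)))"
    by (simp add: sum_distrib_left mult.assoc)
  also have "\<dots> = (\<Sum>K\<in>Pow S. (-1) ^ card K *
       ((\<Sum>L\<in>Pow S. (-1) ^ card L * (F (K \<union> L) - F (K \<union> insert j L)))
      - (\<Sum>L\<in>Pow S. (-1) ^ card L * (F (insert j K \<union> L) - F (insert j K \<union> insert j L)))))"
    by (simp only: step)
  also have "\<dots> = (\<Sum>K\<in>Pow S. \<Sum>L\<in>Pow S. (-1) ^ card K * (-1) ^ card L *
      (\<lambda>U. F U - F (insert j U)) (K \<union> L))"
    by (simp add: sum_distrib_left sum_subtractf algebra_simps)
  also have "\<dots> = (\<Sum>K\<in>Pow S. (-1) ^ card K * (F K - F (insert j K)))"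
    by (rule insert.IH)
  also have "\<dots> = (\<Sum>K\<in>Pow (insert j S). (-1) ^ card K * F K)"
    by (simp only: step)
  finally show ?case .
qed

text \<open>The maximum-minimums identity relative to a base value \<open>t\<close>. Keeping \<open>t\<close> arbitrary makes the
  induction work: adding the index \<open>j\<close> to \<open>K\<close> only raises the base value to \<open>max t (b j)\<close>.\<close>

lemma alternating_sum_Max:
  fixes b :: "'i \<Rightarrow> real"
  assumes "finite S" "S \<noteq> {}"
  shows "(\<Sum>K\<in>Pow S. (-1) ^ card K * Max (insert t (b ` K))) = min 0 (t - Min (b ` S))"
  using assms
proof (induction S arbitrary: t rule: finite_ne_induct)
  case (singleton j)
  then show ?case
    using alternating_sum_Pow_insert[of "{}" j "\<lambda>K. Max (insert t (b ` K))"] by auto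
next
  case (insert j S)
  have fold: "Max (insert t (b ` insert j K)) = Max (insert (max t (b j)) (b ` K))"
    if "K \<in> Pow S" for K
  proof -
    have fin: "finite (b ` K)"
      using insert(1) that by (auto intro: finite_subset)
    show ?thesis
    proof (cases "K = {}")
      case False
      then show ?thesis using fin by (simp add: max.assoc)
    qed simp
  qed
  have "(\<Sum>K\<in>Pow (insert j S). (-1) ^ card K * Max (insert t (b ` K)))
      = (\<Sum>K\<in>Pow S. (-1) ^ card K * (Max (insert t (b ` K)) - Max (insert t (b ` insert j K))))"
    by (rule alternating_sum_Pow_insert) (use insert in auto)
  also have "\<dots> = (\<Sum>K\<in>Pow S. (-1) ^ card K * Max (insert t (b ` K)))
      - (\<Sum>K\<in>Pow S. (-1) ^ card K * Max (insert (max t (b j)) (b ` K)))"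
    unfolding sum_subtractf[symmetric] using fold
    by (intro sum.cong) (simp_all add: algebra_simps)
  also have "\<dots> = min 0 (t - Min (b ` S)) - min 0 (max t (b j) - Min (b ` S))"
    by (simp only: insert.IH)
  also have "\<dots> = min 0 (t - min (b j) (Min (b ` S)))"
    by (auto simp: min_def max_def)
  also have "min (b j) (Min (b ` S)) = Min (b ` insert j S)"
    using insert by simp
  finally show ?case .
qed

section \<open>Strong intersecting submodularity of \<open>\<ell>\<^sub>1\<close> diversities\<close>

text \<open>This rests on \<open>alternating_sum_Max\<close>. The \<open>A i\<close> with \<open>i > 0\<close> may be empty, so each index gets
  the value \<open>Max (f ` (A 0 \<union> A i))\<close>, which is a genuine maximum.\<close>

lemma Max_strongly_intersecting_submodular:
  fixes f :: "'a \<Rightarrow> real"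
  assumes "finite X"
  shows "strongly_intersecting_submodular X (\<lambda>A. Max (f ` A))"
  unfolding strongly_intersecting_submodular_def
proof (intro allI impI, elim conjE)
  fix m :: nat and A :: "nat \<Rightarrow> 'a set"
  assume m: "1 \<le> m" and A: "\<forall>i\<le>m. A i \<subseteq> X" and ne: "A 0 \<noteq> {}"
  define b where "b i = Max (f ` (A 0 \<union> A i))" for i
  have fin: "finite (A i)" if "i \<le> m" for i
    using that A assms finite_subset by blast
  have "Max (f ` (A 0 \<union> (\<Union>i\<in>K. A i))) = Max (insert (Max (f ` A 0)) (b ` K))"
    if K: "K \<in> Pow {1..m}" for K
  proof (rule antisym)
    have finK: "finite K"
      using K by (auto intro: finite_subset)
    then have finU: "finite (A 0 \<union> (\<Union>i\<in>K. A i))"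
      using K fin by auto
    have fin0: "finite (A 0 \<union> A i)" if "i \<in> K" for i
      using K fin that by auto
    show "Max (f ` (A 0 \<union> (\<Union>i\<in>K. A i))) \<le> Max (insert (Max (f ` A 0)) (b ` K))"
    proof (rule Max.boundedI)
      fix v assume "v \<in> f ` (A 0 \<union> (\<Union>i\<in>K. A i))"
      then consider "v \<in> f ` A 0" | i where "i \<in> K" "v \<in> f ` A i" by auto
      then show "v \<le> Max (insert (Max (f ` A 0)) (b ` K))"
      proof cases
        case 1
        then have "v \<le> Max (f ` A 0)" using fin by simp
        also have "\<dots> \<le> Max (insert (Max (f ` A 0)) (b ` K))" using finK by simp
        finally show ?thesis .
      next
        case (2 i)
        then have "v \<le> b i" unfolding b_def using fin0 by (intro Max_ge) auto
        also have "\<dots> \<le> Max (insert (Max (f ` A 0)) (b ` K))" using finK 2 by simp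
        finally show ?thesis .
      qed
    qed (use finU ne in auto)
    show "Max (insert (Max (f ` A 0)) (b ` K)) \<le> Max (f ` (A 0 \<union> (\<Union>i\<in>K. A i)))"
    proof (rule Max.boundedI)
      fix v assume "v \<in> insert (Max (f ` A 0)) (b ` K)"
      then show "v \<le> Max (f ` (A 0 \<union> (\<Union>i\<in>K. A i)))"
        unfolding b_def using ne finU by (auto intro!: Max_mono)
    qed (use finK in auto)
  qed
  then have "(\<Sum>K\<in>Pow {1..m}. (-1) ^ card K * Max (f ` (A 0 \<union> (\<Union>i\<in>K. A i))))
      = (\<Sum>K\<in>Pow {1..m}. (-1) ^ card K * Max (insert (Max (f ` A 0)) (b ` K)))"
    by (intro sum.cong) auto
  also have "\<dots> \<le> 0"
    using m by (subst alternating_sum_Max) auto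
  finally show "(\<Sum>K\<in>Pow {1..m}. (-1) ^ card K * Max (f ` (A 0 \<union> (\<Union>i\<in>K. A i)))) \<le> 0" .
qed

text \<open>All the sets in one of the inequalities contain \<open>A 0\<close>. Hence an inequality depends only on the
  values of the function on the sets containing a chosen point of \<open>A 0\<close>.\<close>

lemma strongly_intersecting_submodular_locally:
  assumes "\<And>x. x \<in> X \<Longrightarrow>
    \<exists>f. strongly_intersecting_submodular X f \<and> (\<forall>A. A \<subseteq> X \<and> x \<in> A \<longrightarrow> g A = f A)"
  shows "strongly_intersecting_submodular X g"
  unfolding strongly_intersecting_submodular_def
proof (intro allI impI, elim conjE)
  fix m :: nat and A :: "nat \<Rightarrow> 'a set"
  assume m: "1 \<le> m" and A: "\<forall>i\<le>m. A i \<subseteq> X" and ne: "A 0 \<noteq> {}"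
  then obtain x where x: "x \<in> A 0" "x \<in> X" by blast
  obtain f where sub: "strongly_intersecting_submodular X f"
    and eq: "\<And>B. B \<subseteq> X \<Longrightarrow> x \<in> B \<Longrightarrow> g B = f B"
    using assms[OF x(2)] by blast
  have "g (A 0 \<union> (\<Union>i\<in>K. A i)) = f (A 0 \<union> (\<Union>i\<in>K. A i))" if "K \<in> Pow {1..m}" for K
    using that A x by (intro eq) (auto, force)
  then have "(\<Sum>K\<in>Pow {1..m}. (-1) ^ card K * g (A 0 \<union> (\<Union>i\<in>K. A i)))
      = (\<Sum>K\<in>Pow {1..m}. (-1) ^ card K * f (A 0 \<union> (\<Union>i\<in>K. A i)))"
    by (intro sum.cong) auto
  also have "\<dots> \<le> 0"
    using sub m A ne unfolding strongly_intersecting_submodular_def by blast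
  finally show "(\<Sum>K\<in>Pow {1..m}. (-1) ^ card K * g (A 0 \<union> (\<Union>i\<in>K. A i))) \<le> 0" .
qed

lemma strongly_intersecting_submodular_sum:
  fixes f :: "'i \<Rightarrow> 'a set \<Rightarrow> real"
  assumes "\<And>i. i \<in> I \<Longrightarrow> strongly_intersecting_submodular X (f i)"
  shows "strongly_intersecting_submodular X (\<lambda>A. \<Sum>i\<in>I. f i A)"
  unfolding strongly_intersecting_submodular_def
proof (intro allI impI)
  fix m :: nat and A :: "nat \<Rightarrow> 'a set"
  assume m: "1 \<le> m" and A: "(\<forall>i\<le>m. A i \<subseteq> X) \<and> A 0 \<noteq> {}"
  have "(\<Sum>K\<in>Pow {1..m}. (-1) ^ card K * (\<Sum>i\<in>I. f i (A 0 \<union> (\<Union>i\<in>K. A i))))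
      = (\<Sum>i\<in>I. \<Sum>K\<in>Pow {1..m}. (-1) ^ card K * f i (A 0 \<union> (\<Union>i\<in>K. A i)))"
    unfolding sum_distrib_left by (rule sum.swap)
  also have "\<dots> \<le> 0"
  proof (rule sum_nonpos)
    fix i assume "i \<in> I"
    from assms[OF this]
    show "(\<Sum>K\<in>Pow {1..m}. (-1) ^ card K * f i (A 0 \<union> (\<Union>i\<in>K. A i))) \<le> 0"
      using m A unfolding strongly_intersecting_submodular_def by blast
  qed
  finally show "(\<Sum>K\<in>Pow {1..m}. (-1) ^ card K * (\<Sum>i\<in>I. f i (A 0 \<union> (\<Union>i\<in>K. A i)))) \<le> 0" .
qed

lemma strongly_intersecting_submodular_add:
  assumes "strongly_intersecting_submodular X f" "strongly_intersecting_submodular X g"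
  shows "strongly_intersecting_submodular X (\<lambda>A. f A + g A)"
  using strongly_intersecting_submodular_sum[of "UNIV :: bool set" X "\<lambda>b. if b then f else g"]
    assms by (simp add: UNIV_bool add.commute)

text \<open>The width of a coordinate is its maximum minus its minimum. Writing the minimum through the
  maximum of the negated coordinate leaves only terms of one kind.\<close>

lemma l1_diversity_image:
  assumes "finite A" "A \<noteq> {}"
  shows "l1_diversity k (\<phi> ` A)
    = (\<Sum>i=1..k. Max ((\<lambda>a. \<phi> a i) ` A) + Max ((\<lambda>a. - \<phi> a i) ` A))"
proof -
  have "Max {\<bar>p i - q i\<bar> |p q. p \<in> \<phi> ` A \<and> q \<in> \<phi> ` A}
      = Max ((\<lambda>a. \<phi> a i) ` A) + Max ((\<lambda>a. - \<phi> a i) ` A)" (is "Max ?D = Max ?P + Max ?N") for i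
  proof (rule Max_eqI)
    have "?D = (\<lambda>(a, b). \<bar>\<phi> a i - \<phi> b i\<bar>) ` (A \<times> A)" by auto
    then show "finite ?D" using assms(1) by simp
    have "Max ?P \<in> ?P" "Max ?N \<in> ?N" using assms by (auto intro!: Max_in simp del: Max_in)
    then obtain a b where ab: "a \<in> A" "b \<in> A" "Max ?P = \<phi> a i" "Max ?N = - \<phi> b i"
      by auto
    have ge: "\<phi> c i \<le> Max ?P" "- \<phi> c i \<le> Max ?N" if "c \<in> A" for c
      using assms(1) that by (auto intro!: Max_ge)
    show "v \<le> Max ?P + Max ?N" if v: "v \<in> ?D" for v
    proof -
      obtain c d where "c \<in> A" "d \<in> A" "v = \<bar>\<phi> c i - \<phi> d i\<bar>"
        using v by auto
      then show ?thesis using ge[of c] ge[of d] by auto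
    qed
    have "Max ?P + Max ?N = \<bar>\<phi> a i - \<phi> b i\<bar>"
      using ab ge[of b] by auto
    then show "Max ?P + Max ?N \<in> ?D" using ab by blast
  qed
  then show ?thesis using assms by (simp add: l1_diversity_def)
qed

lemma l1_embeddable_singleton:
  assumes "l1_embeddable X \<delta>" "x \<in> X"
  shows "\<delta> {x} = 0"
proof -
  obtain k \<phi> where "\<And>A. finite A \<Longrightarrow> A \<subseteq> X \<Longrightarrow> l1_diversity k (\<phi> ` A) = \<delta> A"
    using assms(1) unfolding l1_embeddable_def by blast
  from this[of "{x}"] show ?thesis
    using assms(2) l1_diversity_image[of "{x}" k \<phi>] by simp
qed

lemma l1_embeddable_empty:
  assumes "l1_embeddable X \<delta>"
  shows "\<delta> {} = 0"
  using assms unfolding l1_embeddable_def l1_diversity_def by force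

lemma l1_embeddable_strongly_intersecting_submodular:
  assumes "finite X" "l1_embeddable X \<delta>"
  shows "strongly_intersecting_submodular X \<delta>"
proof -
  obtain k \<phi> where \<phi>: "\<And>A. finite A \<Longrightarrow> A \<subseteq> X \<Longrightarrow> l1_diversity k (\<phi> ` A) = \<delta> A"
    using assms(2) unfolding l1_embeddable_def by blast
  define f where
    "f A = (\<Sum>i=1..k. Max ((\<lambda>a. \<phi> a i) ` A) + Max ((\<lambda>a. - \<phi> a i) ` A))" for A
  show ?thesis
  proof (rule strongly_intersecting_submodular_locally, intro exI conjI allI impI; (elim conjE)?)
    show "strongly_intersecting_submodular X f"
      unfolding f_def
      by (intro strongly_intersecting_submodular_sum strongly_intersecting_submodular_add
          Max_strongly_intersecting_submodular assms(1))
    show "\<delta> A = f A" if "A \<subseteq> X" "x \<in> A" for x A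
    proof -
      have "finite A" using that(1) assms(1) by (rule finite_subset)
      then show ?thesis using \<phi>[of A] l1_diversity_image[of A k \<phi>] that
        unfolding f_def by auto
    qed
  qed
qed

section \<open>Diversities from strong intersecting submodularity\<close>

text \<open>The case \<open>m = 1\<close> of the inequality.\<close>

lemma strongly_intersecting_submodular_mono:
  assumes "strongly_intersecting_submodular X \<delta>" "A \<subseteq> B" "B \<subseteq> X" "A \<noteq> {}"
  shows "\<delta> A \<le> \<delta> B"
proof -
  define D where "D i = (if i = 0 then A else B)" for i :: nat
  have "(\<forall>i\<le>1. D i \<subseteq> X) \<and> D 0 \<noteq> {}"
    using assms by (auto simp: D_def)
  then have "(\<Sum>K\<in>Pow {1..1}. (-1) ^ card K * \<delta> (D 0 \<union> (\<Union>i\<in>K. D i))) \<le> 0"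
    using assms(1) unfolding strongly_intersecting_submodular_def by blast
  also have "Pow {1..1::nat} = {{}, {1}}" by auto
  finally show ?thesis using assms(2) by (simp add: D_def Un_absorb1)
qed

text \<open>The case \<open>m = 2\<close> of the inequality.\<close>

lemma strongly_intersecting_submodular_pair:
  assumes "strongly_intersecting_submodular X \<delta>" "A \<subseteq> X" "B \<subseteq> X" "C \<subseteq> X" "B \<noteq> {}"
  shows "\<delta> (A \<union> B \<union> C) + \<delta> B \<le> \<delta> (A \<union> B) + \<delta> (B \<union> C)"
proof -
  define D where "D i = (if i = 0 then B else if i = 1 then A else C)" for i :: nat
  have Pow12: "Pow {1..2::nat} = {{}, {1}, {2}, {1, 2}}"
  proof -
    have "{1..2::nat} = insert 1 (insert 2 {})" by auto
    then show ?thesis by (simp only: Pow_insert Pow_empty) auto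
  qed
  have "(\<forall>i\<le>2. D i \<subseteq> X) \<and> D 0 \<noteq> {}"
    using assms by (auto simp: D_def)
  then have "(\<Sum>K\<in>Pow {1..2}. (-1) ^ card K * \<delta> (D 0 \<union> (\<Union>i\<in>K. D i))) \<le> 0"
    using assms(1) unfolding strongly_intersecting_submodular_def
    by (meson one_le_numeral)
  then show ?thesis
    unfolding Pow12 D_def
    by (simp add: doubleton_eq_iff Un_ac)
qed

text \<open>The triangle inequality follows from the case \<open>m = 2\<close> based at \<open>B\<close>, with monotonicity used to
  pass from \<open>A \<union> C\<close> to \<open>A \<union> B \<union> C\<close> and to see that \<open>\<delta> B\<close>, which is at least the
  value on a point, is nonnegative.\<close>

lemma strongly_intersecting_submodular_diversity:
  assumes "\<delta> {} = 0" "\<And>x. x \<in> X \<Longrightarrow> \<delta> {x} = 0" "strongly_intersecting_submodular X \<delta>"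
  shows "diversity X \<delta>"
  unfolding diversity_def
proof (intro conjI allI impI; elim conjE)
  fix A assume "finite A" "A \<subseteq> X" "card A \<le> 1"
  then show "\<delta> A = 0"
    using assms(1,2) by (cases "card A") (auto simp: card_1_singleton_iff)
next
  fix A B C assume sub: "A \<subseteq> X" "B \<subseteq> X" "C \<subseteq> X" and "B \<noteq> {}"
  have nonneg: "0 \<le> \<delta> S" if S: "S \<subseteq> X" for S
  proof (cases "S = {}")
    case False
    then obtain s where s: "s \<in> S" by blast
    then have "\<delta> {s} \<le> \<delta> S"
      using S by (intro strongly_intersecting_submodular_mono[OF assms(3)]) auto
    then show ?thesis using assms(2) s S by auto
  qed (use assms(1) in simp)
  have "\<delta> (A \<union> C) \<le> \<delta> (A \<union> B \<union> C)"
  proof (cases "A \<union> C = {}")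
    case False
    then show ?thesis
      using sub by (intro strongly_intersecting_submodular_mono[OF assms(3)]) auto
  next
    case True
    then show ?thesis using nonneg sub assms(1) by simp
  qed
  then show "\<delta> (A \<union> C) \<le> \<delta> (A \<union> B) + \<delta> (B \<union> C)"
    using strongly_intersecting_submodular_pair[OF assms(3) sub \<open>B \<noteq> {}\<close>] nonneg[OF sub(2)]
    by linarith
qed

section \<open>The Moebius representation and its weights\<close>

text \<open>Up to sign, this is the Moebius transform of \<open>R \<mapsto> \<delta> (X - R)\<close> at \<open>S\<close>. It is written
  with \<open>K = S - R\<close>, so that it has the shape of a submodularity sum with base \<open>X - S\<close>.\<close>

definition moebius_weight :: "'a set \<Rightarrow> ('a set \<Rightarrow> real) \<Rightarrow> 'a set \<Rightarrow> real" where
  "moebius_weight X \<delta> S = - (\<Sum>K\<in>Pow S. (-1) ^ card K * \<delta> ((X - S) \<union> K))"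

text \<open>Moebius inversion for \<open>R \<mapsto> \<delta> (X - R)\<close>, evaluated at \<open>R = X - A\<close>; the subsets of
  \<open>X - A\<close> are the sets that miss \<open>A\<close>.\<close>

lemma moebius_representation:
  assumes "finite X" "A \<subseteq> X"
  shows "\<delta> A = - (\<Sum>S\<in>Pow (X - A). moebius_weight X \<delta> S)"
proof -
  define f where "f R = \<delta> (X - R)" for R
  define g where "g S = (\<Sum>R\<in>Pow S. (-1) ^ card R * f R)" for S
  have weight: "- moebius_weight X \<delta> S = (-1) ^ card S * g S" if S: "S \<subseteq> X" for S
  proof -
    have fin: "finite S" using S assms(1) finite_subset by blast
    have "- moebius_weight X \<delta> S = (\<Sum>K\<in>Pow S. (-1) ^ card K * \<delta> ((X - S) \<union> K))"
      by (simp add: moebius_weight_def)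
    also have "\<dots> = (\<Sum>R\<in>Pow S. (-1) ^ card (S - R) * f R)"
    proof (rule sum.reindex_bij_witness[of _ "\<lambda>R. S - R" "\<lambda>R. S - R"])
      fix K assume "K \<in> Pow S"
      then have "X - (S - K) = (X - S) \<union> K" "S - (S - K) = K" using S by auto
      then show "(-1) ^ card (S - (S - K)) * f (S - K) = (-1) ^ card K * \<delta> ((X - S) \<union> K)"
        by (simp add: f_def)
    qed auto
    also have "\<dots> = (-1) ^ card S * g S"
      unfolding g_def sum_distrib_left
    proof (rule sum.cong)
      fix R assume "R \<in> Pow S"
      then have "card S = card (S - R) + card R"
        using fin by (metis Pow_iff card_Diff_subset card_mono finite_subset le_add_diff_inverse2)
      then show "(-1) ^ card (S - R) * f R = (-1) ^ card S * ((-1) ^ card R * f R)"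
        by (simp add: power_add)
    qed simp
    finally show ?thesis .
  qed
  have "f (X - A) = (\<Sum>S\<in>Pow (X - A). (-1) ^ card S * g S)"
    by (rule inclusion_exclusion_symmetric) (use assms g_def in auto)
  also have "\<dots> = (\<Sum>S\<in>Pow (X - A). - moebius_weight X \<delta> S)"
    by (intro sum.cong refl weight[symmetric]) auto
  also have "f (X - A) = \<delta> A" using assms(2) by (simp add: f_def double_diff)
  finally show ?thesis by (simp add: sum_negf)
qed

text \<open>The weight is minus the alternating sum with \<open>A\<^sub>0 = X - S\<close> and the points of \<open>S\<close> as
  \<open>A\<^sub>1, \<dots>, A\<^sub>m\<close>. The two exceptions are what the inequalities require: \<open>S \<noteq> {}\<close>
  gives \<open>m \<ge> 1\<close>, and \<open>S \<noteq> X\<close> gives \<open>A\<^sub>0 \<noteq> {}\<close>.\<close>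

lemma moebius_weight_nonneg:
  assumes "finite X" "strongly_intersecting_submodular X \<delta>" "S \<subseteq> X" "S \<noteq> {}" "S \<noteq> X"
  shows "0 \<le> moebius_weight X \<delta> S"
proof -
  have fin: "finite S" using assms finite_subset by blast
  obtain h where h: "bij_betw h {1..card S} S"
    using ex_bij_betw_nat_finite_1[OF fin] by blast
  define A where "A i = (if i = 0 then X - S else {h i})" for i
  have "\<forall>i\<le>card S. A i \<subseteq> X"
    using h assms(3) by (auto simp: A_def bij_betw_def)
  moreover have "A 0 \<noteq> {}" using assms by (auto simp: A_def)
  moreover have "1 \<le> card S" using fin assms(4) by (simp add: Suc_le_eq card_gt_0_iff)
  ultimately have
    "(\<Sum>K\<in>Pow {1..card S}. (-1) ^ card K * \<delta> (A 0 \<union> (\<Union>i\<in>K. A i))) \<le> 0"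
    using assms(2) unfolding strongly_intersecting_submodular_def by blast
  also have "(\<Sum>K\<in>Pow {1..card S}. (-1) ^ card K * \<delta> (A 0 \<union> (\<Union>i\<in>K. A i)))
      = (\<Sum>K\<in>Pow {1..card S}. (-1) ^ card (h ` K) * \<delta> ((X - S) \<union> h ` K))"
  proof (rule sum.cong)
    fix K assume K: "K \<in> Pow {1..card S}"
    then have "card (h ` K) = card K"
      using h by (intro card_image) (auto simp: bij_betw_def intro: inj_on_subset)
    moreover have "(\<Union>i\<in>K. A i) = h ` K" using K by (force simp: A_def)
    ultimately show "(-1) ^ card K * \<delta> (A 0 \<union> (\<Union>i\<in>K. A i))
        = (-1) ^ card (h ` K) * \<delta> ((X - S) \<union> h ` K)"
      by (simp add: A_def)
  qed simp
  also have "\<dots> = (\<Sum>K\<in>Pow S. (-1) ^ card K * \<delta> ((X - S) \<union> K))"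
    by (rule sum.reindex_bij_betw[OF bij_betw_Pow[OF h]])
  finally show ?thesis by (simp add: moebius_weight_def)
qed

section \<open>Negative type\<close>

lemma sum_swap3:
  "(\<Sum>a\<in>A. \<Sum>b\<in>B. \<Sum>c\<in>C. f a b c) = (\<Sum>c\<in>C. \<Sum>a\<in>A. \<Sum>b\<in>B. f a b c)"
proof -
  have "(\<Sum>a\<in>A. \<Sum>b\<in>B. \<Sum>c\<in>C. f a b c) = (\<Sum>a\<in>A. \<Sum>c\<in>C. \<Sum>b\<in>B. f a b c)"
    by (rule sum.cong[OF refl sum.swap])
  also have "\<dots> = (\<Sum>c\<in>C. \<Sum>a\<in>A. \<Sum>b\<in>B. f a b c)"
    by (rule sum.swap)
  finally show ?thesis .
qed

text \<open>Negative type for a family of sets in which repetitions may occur: the coefficients of equal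
  members are added up. Repetitions arise below, since different \<open>K\<close> can yield the same union
  \<open>A 0 \<union> (\<Union>i\<in>K. A i)\<close>.\<close>

lemma negative_type_family:
  fixes c :: "'i \<Rightarrow> real"
  assumes "negative_type X \<delta>" "finite X" "finite I"
    and B: "\<And>i. i \<in> I \<Longrightarrow> B i \<subseteq> X \<and> B i \<noteq> {}" and "(\<Sum>i\<in>I. c i) = 0"
  shows "(\<Sum>i\<in>I. \<Sum>j\<in>I. c i * c j * \<delta> (B i \<union> B j)) \<le> 0"
proof -
  define y where "y A = sum c {i \<in> I. B i = A}" for A
  have group: "(\<Sum>A\<in>Pow X. y A * h A) = (\<Sum>i\<in>I. c i * h (B i))" for h :: "'a set \<Rightarrow> real"
  proof -
    have "(\<Sum>i\<in>I. c i * h (B i)) = (\<Sum>A\<in>Pow X. \<Sum>i\<in>{i \<in> I. B i = A}. c i * h (B i))"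
      using assms(2,3) B by (intro sum.group[symmetric]) auto
    also have "\<dots> = (\<Sum>A\<in>Pow X. y A * h A)"
      unfolding y_def sum_distrib_right by (intro sum.cong) auto
    finally show ?thesis by simp
  qed
  have y0: "y {} = 0" unfolding y_def using B by (intro sum.neutral) auto
  have "(\<Sum>A\<in>Pow X - {{}}. y A) = (\<Sum>A\<in>Pow X. y A * 1)"
    using y0 assms(2) by (simp add: sum_diff1)
  also have "\<dots> = 0" using group[of "\<lambda>_. 1"] assms(5) by simp
  finally have "(\<Sum>A\<in>Pow X. \<Sum>C\<in>Pow X. y A * y C * \<delta> (A \<union> C)) \<le> 0"
    using assms(1) y0 unfolding negative_type_def by blast
  also have "(\<Sum>A\<in>Pow X. \<Sum>C\<in>Pow X. y A * y C * \<delta> (A \<union> C))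
      = (\<Sum>A\<in>Pow X. y A * (\<Sum>C\<in>Pow X. y C * \<delta> (A \<union> C)))"
    by (simp add: sum_distrib_left mult.assoc)
  also have "\<dots> = (\<Sum>i\<in>I. \<Sum>j\<in>I. c i * c j * \<delta> (B i \<union> B j))"
    unfolding group by (simp add: sum_distrib_left mult.assoc)
  finally show ?thesis .
qed

lemma negative_type_strongly_intersecting_submodular:
  assumes "finite X" "negative_type X \<delta>"
  shows "strongly_intersecting_submodular X \<delta>"
  unfolding strongly_intersecting_submodular_def
proof (intro allI impI, elim conjE)
  fix m :: nat and A :: "nat \<Rightarrow> 'a set"
  assume m: "1 \<le> m" and A: "\<forall>i\<le>m. A i \<subseteq> X" and ne: "A 0 \<noteq> {}"
  define B where "B K = A 0 \<union> (\<Union>i\<in>K. A i)" for K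
  have "(\<Sum>K\<in>Pow {1..m}. (-1) ^ card K) = (0::real)"
    using m by (intro alternating_sum_Pow_const) auto
  moreover have "B K \<subseteq> X \<and> B K \<noteq> {}" if "K \<in> Pow {1..m}" for K
    unfolding B_def using A ne that by (auto, force)
  ultimately have "(\<Sum>K\<in>Pow {1..m}. \<Sum>L\<in>Pow {1..m}.
      (-1) ^ card K * (-1) ^ card L * \<delta> (B K \<union> B L)) \<le> 0"
    by (intro negative_type_family[OF assms(2,1)]) auto
  moreover have "B K \<union> B L = B (K \<union> L)" for K L by (auto simp: B_def)
  ultimately show "(\<Sum>K\<in>Pow {1..m}. (-1) ^ card K * \<delta> (A 0 \<union> (\<Union>i\<in>K. A i))) \<le> 0"
    using alternating_double_sum_union[of "{1..m}" "\<lambda>K. \<delta> (B K)"] by (simp add: B_def)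
qed

text \<open>By the Moebius representation the quadratic form is minus a weighted sum of squares \<open>q S * q S\<close>,
  because \<open>A \<union> B\<close> misses \<open>S\<close> iff both \<open>A\<close> and \<open>B\<close> do.\<close>

lemma strongly_intersecting_submodular_negative_type:
  assumes "finite X" "strongly_intersecting_submodular X \<delta>"
  shows "negative_type X \<delta>"
  unfolding negative_type_def
proof (intro allI impI, elim conjE)
  fix x :: "'a set \<Rightarrow> real"
  assume x0: "x {} = 0" and "(\<Sum>A\<in>Pow X - {{}}. x A) = 0"
  then have sum_x: "(\<Sum>A\<in>Pow X. x A) = 0" using assms(1) by (simp add: sum_diff1)
  define w where "w = moebius_weight X \<delta>"
  define q where "q S = (\<Sum>A\<in>Pow X. x A * of_bool (A \<inter> S = {}))" for S
  have expand: "\<delta> (A \<union> B) = - (\<Sum>S\<in>Pow X. w S * (of_bool (A \<inter> S = {}) * of_bool (B \<inter> S = {})))"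
    if "A \<in> Pow X" "B \<in> Pow X" for A B
  proof -
    have "\<delta> (A \<union> B) = - (\<Sum>S\<in>Pow (X - (A \<union> B)). w S)"
      unfolding w_def using that assms(1) by (intro moebius_representation) auto
    also have "(\<Sum>S\<in>Pow (X - (A \<union> B)). w S)
        = (\<Sum>S\<in>Pow X. w S * (of_bool (A \<inter> S = {}) * of_bool (B \<inter> S = {})))"
      using assms(1) by (intro sum.mono_neutral_cong_left) (auto simp: of_bool_def)
    finally show ?thesis .
  qed
  have "(\<Sum>A\<in>Pow X. \<Sum>B\<in>Pow X. x A * x B * \<delta> (A \<union> B))
      = (\<Sum>A\<in>Pow X. \<Sum>B\<in>Pow X. \<Sum>S\<in>Pow X.
          - (w S * ((x A * of_bool (A \<inter> S = {})) * (x B * of_bool (B \<inter> S = {})))))"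
    by (intro sum.cong) (simp_all add: expand sum_distrib_left sum_negf mult_ac)
  also have "\<dots> = (\<Sum>S\<in>Pow X. \<Sum>A\<in>Pow X. \<Sum>B\<in>Pow X.
          - (w S * ((x A * of_bool (A \<inter> S = {})) * (x B * of_bool (B \<inter> S = {})))))"
    by (rule sum_swap3)
  also have "\<dots> = (\<Sum>S\<in>Pow X. - (w S * (q S * q S)))"
    unfolding q_def sum_product by (simp add: sum_distrib_left sum_negf)
  also have "\<dots> \<le> 0"
  proof (rule sum_nonpos)
    fix S assume S: "S \<in> Pow X"
    consider "S = {}" | "S = X" | "S \<noteq> {}" "S \<noteq> X" by blast
    then show "- (w S * (q S * q S)) \<le> 0"
    proof cases
      case 1
      then show ?thesis using sum_x by (simp add: q_def)
    next
      case 2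
      then have "q S = 0" unfolding q_def using x0
        by (intro sum.neutral) (auto simp: Int_absorb2)
      then show ?thesis by simp
    next
      case 3
      then have "0 \<le> w S"
        unfolding w_def using S assms by (intro moebius_weight_nonneg) auto
      then show ?thesis by simp
    qed
  qed
  finally show "(\<Sum>A\<in>Pow X. \<Sum>B\<in>Pow X. x A * x B * \<delta> (A \<union> B)) \<le> 0" .
qed

section \<open>Embedding sums of cuts\<close>

text \<open>Each \<open>S\<close> in \<open>I\<close> contributes the coordinate \<open>w S\<close> times the indicator of \<open>S\<close>, whose width
  on \<open>A\<close> is \<open>w S\<close> or \<open>0\<close> according to whether \<open>S\<close> cuts \<open>A\<close>. The empty set gives the zero
  coordinate whatever its weight; admitting it keeps the dimension positive in the applications.\<close>

lemma cut_sum_l1_embeddable: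
  fixes w :: "'a set \<Rightarrow> real"
  assumes "finite I" "I \<noteq> {}" and w: "\<And>S. S \<in> I \<Longrightarrow> S \<noteq> {} \<Longrightarrow> 0 \<le> w S"
  shows "l1_embeddable X (\<lambda>A. \<Sum>S\<in>I. w S * of_bool (A \<inter> S \<noteq> {} \<and> A - S \<noteq> {}))"
proof -
  define k where "k = card I"
  obtain e where e: "bij_betw e {1..k} I"
    unfolding k_def using ex_bij_betw_nat_finite_1[OF assms(1)] by blast
  define \<phi> where "\<phi> a = restrict (\<lambda>i. w (e i) * of_bool (a \<in> e i)) {1..k}" for a
  have "l1_diversity k (\<phi> ` A) = (\<Sum>S\<in>I. w S * of_bool (A \<inter> S \<noteq> {} \<and> A - S \<noteq> {}))"
    if fin: "finite A" for A
  proof (cases "A = {}")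
    case True
    then show ?thesis by (simp add: l1_diversity_def)
  next
    case False
    have "Max ((\<lambda>a. \<phi> a i) ` A) + Max ((\<lambda>a. - \<phi> a i) ` A)
        = w (e i) * of_bool (A \<inter> e i \<noteq> {} \<and> A - e i \<noteq> {})" if i: "i \<in> {1..k}" for i
    proof -
      have \<phi>: "\<phi> a i = w (e i) * of_bool (a \<in> e i)" for a using i by (simp add: \<phi>_def)
      have eI: "e i \<in> I" using e i by (auto simp: bij_betw_def)
      consider "A \<inter> e i = {}" | "A \<subseteq> e i" | "A \<inter> e i \<noteq> {}" "A - e i \<noteq> {}" by blast
      then show ?thesis
      proof cases
        case 1
        then have "(\<lambda>a. \<phi> a i) ` A = {0}" "(\<lambda>a. - \<phi> a i) ` A = {0}"
          using False by (auto simp: \<phi> image_def)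
        then show ?thesis using 1 by simp
      next
        case 2
        then have "(\<lambda>a. \<phi> a i) ` A = {w (e i)}" "(\<lambda>a. - \<phi> a i) ` A = {- w (e i)}"
          using False by (auto simp: \<phi> image_def)
        moreover have "A - e i = {}" using 2 by blast
        ultimately show ?thesis by simp
      next
        case 3
        then have "0 \<le> w (e i)" using w[OF eI] by auto
        moreover have "(\<lambda>a. \<phi> a i) ` A = {0, w (e i)}" "(\<lambda>a. - \<phi> a i) ` A = {0, - w (e i)}"
          using 3 by (auto simp: \<phi> image_def of_bool_def)
        ultimately show ?thesis using 3 by simp
      qed
    qed
    then have "l1_diversity k (\<phi> ` A)
        = (\<Sum>i=1..k. w (e i) * of_bool (A \<inter> e i \<noteq> {} \<and> A - e i \<noteq> {}))"
      unfolding l1_diversity_image[OF fin False] by (intro sum.cong) auto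
    also have "\<dots> = (\<Sum>S\<in>I. w S * of_bool (A \<inter> S \<noteq> {} \<and> A - S \<noteq> {}))"
      by (rule sum.reindex_bij_betw[OF e])
    finally show ?thesis .
  qed
  moreover have "\<phi> \<in> X \<rightarrow> real_space k"
    by (auto simp: \<phi>_def real_space_def)
  moreover have "1 \<le> k"
    unfolding k_def using assms(1,2) by (simp add: Suc_le_eq card_gt_0_iff)
  ultimately show ?thesis unfolding l1_embeddable_def by blast
qed

text \<open>On sets containing \<open>x\<close>, \<open>\<delta>\<close> is a sum of cuts. Since \<open>\<delta> {x} = 0\<close>, the representations
  of \<open>\<delta> {x}\<close> and of \<open>\<delta> A\<close> may be subtracted: the \<open>S\<close> that miss \<open>A\<close> cancel, among them
  \<open>S = {}\<close>, and \<open>S = X\<close> does not occur.\<close>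

lemma based_l1_representation:
  assumes "finite X" "strongly_intersecting_submodular X \<delta>" "x \<in> X" "\<delta> {x} = 0"
  obtains \<delta>1 where "l1_embeddable X \<delta>1" "\<And>A. A \<subseteq> X \<Longrightarrow> x \<in> A \<Longrightarrow> \<delta> A = \<delta>1 A"
proof
  define w where "w = moebius_weight X \<delta>"
  define \<delta>1 where
    "\<delta>1 A = (\<Sum>S\<in>Pow (X - {x}). w S * of_bool (A \<inter> S \<noteq> {} \<and> A - S \<noteq> {}))" for A
  have "0 \<le> w S" if "S \<in> Pow (X - {x})" "S \<noteq> {}" for S
    unfolding w_def using that assms by (intro moebius_weight_nonneg) auto
  then show "l1_embeddable X \<delta>1"
    unfolding \<delta>1_def using assms(1) by (intro cut_sum_l1_embeddable) auto
  show "\<delta> A = \<delta>1 A" if A: "A \<subseteq> X" "x \<in> A" for A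
  proof -
    have sub: "Pow (X - A) \<subseteq> Pow (X - {x})" using A(2) by auto
    have "\<delta> A = \<delta> A - \<delta> {x}" using assms(4) by simp
    also have "\<dots> = (\<Sum>S\<in>Pow (X - {x}). w S) - (\<Sum>S\<in>Pow (X - A). w S)"
      using moebius_representation[OF assms(1), of _ \<delta>] A assms(3) by (simp add: w_def)
    also have "\<dots> = (\<Sum>S\<in>Pow (X - {x}) - Pow (X - A). w S)"
      using sub assms(1) by (simp add: sum_diff)
    also have "\<dots> = \<delta>1 A"
      unfolding \<delta>1_def using A assms(1)
      by (intro sum.mono_neutral_cong_left) (auto simp: of_bool_def)
    finally show ?thesis .
  qed
qed

section \<open>The equivalence\<close>

text \<open>Removing a point \<open>x\<close> of \<open>A 0\<close> from every \<open>A i\<close>, or adding \<open>x\<close> to every \<open>A i\<close>,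
  passes between the two families of inequalities.\<close>

lemma strongly_submodular_based_at_iff:
  "(\<forall>x\<in>X. strongly_submodular (X - {x}) (based_at \<delta> x))
    \<longleftrightarrow> strongly_intersecting_submodular X \<delta>" (is "?L \<longleftrightarrow> ?R")
proof
  assume L: ?L
  show ?R
    unfolding strongly_intersecting_submodular_def
  proof (intro allI impI, elim conjE)
    fix m :: nat and A :: "nat \<Rightarrow> 'a set"
    assume m: "1 \<le> m" and A: "\<forall>i\<le>m. A i \<subseteq> X" and "A 0 \<noteq> {}"
    then obtain x where x: "x \<in> A 0" by blast
    have "(\<Sum>K\<in>Pow {1..m}. (-1) ^ card K *
        based_at \<delta> x ((A 0 - {x}) \<union> (\<Union>i\<in>K. A i - {x}))) \<le> 0"
      using L[rule_format, of x, unfolded strongly_submodular_def, rule_format,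
          of m "\<lambda>i. A i - {x}"] m A x by blast
    moreover have "based_at \<delta> x ((A 0 - {x}) \<union> (\<Union>i\<in>K. A i - {x}))
        = \<delta> (A 0 \<union> (\<Union>i\<in>K. A i))" for K
      unfolding based_at_def using x by (intro arg_cong[where f = \<delta>]) auto
    ultimately show "(\<Sum>K\<in>Pow {1..m}. (-1) ^ card K * \<delta> (A 0 \<union> (\<Union>i\<in>K. A i))) \<le> 0"
      by simp
  qed
next
  assume R: ?R
  show ?L
    unfolding strongly_submodular_def
  proof (intro ballI allI impI)
    fix x and m :: nat and A :: "nat \<Rightarrow> 'a set"
    assume x: "x \<in> X" and m: "1 \<le> m" and A: "\<forall>i\<le>m. A i \<subseteq> X - {x}"
    define B where "B i = insert x (A i)" for i
    have "(\<forall>i\<le>m. B i \<subseteq> X) \<and> B 0 \<noteq> {}"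
      using A x by (auto simp: B_def)
    then have "(\<Sum>K\<in>Pow {1..m}. (-1) ^ card K * \<delta> (B 0 \<union> (\<Union>i\<in>K. B i))) \<le> 0"
      using R m unfolding strongly_intersecting_submodular_def by blast
    moreover have "B 0 \<union> (\<Union>i\<in>K. B i) = A 0 \<union> (\<Union>i\<in>K. A i) \<union> {x}" for K
      by (auto simp: B_def)
    ultimately show
      "(\<Sum>K\<in>Pow {1..m}. (-1) ^ card K * based_at \<delta> x (A 0 \<union> (\<Union>i\<in>K. A i))) \<le> 0"
      by (simp add: based_at_def)
  qed
qed

theorem proposition6:
  fixes X :: "'a set" and \<delta> :: "'a set \<Rightarrow> real"
  assumes "finite X" and "\<delta> {} = 0"
  shows
    "(diversity X \<delta> \<and> negative_type X \<delta> \<longleftrightarrow>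
        (\<forall>x\<in>X. strongly_submodular (X - {x}) (based_at \<delta> x) \<and> based_at \<delta> x {} = 0)) \<and>
     ((\<forall>x\<in>X. strongly_submodular (X - {x}) (based_at \<delta> x) \<and> based_at \<delta> x {} = 0) \<longleftrightarrow>
        (\<forall>x\<in>X. \<delta> {x} = 0) \<and> strongly_intersecting_submodular X \<delta>) \<and>
     ((\<forall>x\<in>X. \<delta> {x} = 0) \<and> strongly_intersecting_submodular X \<delta> \<longleftrightarrow>
        (\<forall>x\<in>X. \<exists>\<delta>1. diversity X \<delta>1 \<and> l1_embeddable X \<delta>1 \<and>
           (\<forall>A. A \<subseteq> X \<and> x \<in> A \<longrightarrow> \<delta> A = \<delta>1 A)))"
    (is "(?i \<longleftrightarrow> ?ii) \<and> (?ii \<longleftrightarrow> ?iii) \<and> (?iii \<longleftrightarrow> ?iv)")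
proof -
  have "?i \<longleftrightarrow> ?iii"
  proof
    assume i: ?i
    then have "\<forall>x\<in>X. \<delta> {x} = 0" by (simp add: diversity_def)
    then show ?iii
      using i negative_type_strongly_intersecting_submodular[OF assms(1)] by blast
  next
    assume ?iii
    then show ?i
      using strongly_intersecting_submodular_diversity[of \<delta> X] assms
        strongly_intersecting_submodular_negative_type[OF assms(1)] by blast
  qed
  moreover have "?ii \<longleftrightarrow> ?iii"
    using strongly_submodular_based_at_iff[of X \<delta>] by (auto simp: based_at_def)
  moreover have "?iii \<longleftrightarrow> ?iv"
  proof
    assume iii: ?iii
    show ?iv
    proof
      fix x assume "x \<in> X"
      then obtain \<delta>1 where emb: "l1_embeddable X \<delta>1"
        and eq: "\<And>A. A \<subseteq> X \<Longrightarrow> x \<in> A \<Longrightarrow> \<delta> A = \<delta>1 A"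
        using based_l1_representation[OF assms(1)] iii by blast
      have "diversity X \<delta>1"
        using emb assms(1) by (intro strongly_intersecting_submodular_diversity
            l1_embeddable_empty l1_embeddable_singleton
            l1_embeddable_strongly_intersecting_submodular)
      then show "\<exists>\<delta>1. diversity X \<delta>1 \<and> l1_embeddable X \<delta>1 \<and>
          (\<forall>A. A \<subseteq> X \<and> x \<in> A \<longrightarrow> \<delta> A = \<delta>1 A)"
        using emb eq by blast
    qed
  next
    assume iv: ?iv
    have "\<delta> {x} = 0" if "x \<in> X" for x
    proof -
      obtain \<delta>1 where "l1_embeddable X \<delta>1" "\<delta> {x} = \<delta>1 {x}"
        using iv \<open>x \<in> X\<close> by blast
      then show ?thesis using l1_embeddable_singleton \<open>x \<in> X\<close> by fastforce
    qed
    moreover have "strongly_intersecting_submodular X \<delta>"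
      using iv l1_embeddable_strongly_intersecting_submodular[OF assms(1)]
      by (intro strongly_intersecting_submodular_locally) meson
    ultimately show ?iii by blast
  qed
  ultimately show ?thesis by blast
qed

end
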